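(* For every finite simple $K_5$-minor-free graph $G$, there exists a forest $F$ (a subgraph of $G$ without cycles) such that $G-E(F)$ is $2$-degenerate.
   Context: A graph $H$ is a minor of $G$ if $H$ can be obtained from $G$ by deleting vertices, deleting edges and contracting edges; $G$ is $K_5$-minor-free if $K_5$ is not a minor of $G$. $G-E(F)$ is the graph with vertex set $V(G)$ obtained by deleting the edges of $F$. A graph is $2$-degenerate if every subgraph of it has a vertex of degree at most $2$. *)

theory Defs
  imports Main
begin

definition simple_graph :: "'a set \<Rightarrow> 'a set set \<Rightarrow> bool" where
  "simple_graph V E \<longleftrightarrow> (\<forall>e\<in>E. \<exists>u v. e = {u, v} \<and> u \<noteq> v \<and> u \<in> V \<and> v \<in> V)"

inductive minor_step :: "'a set \<times> 'a set set \<Rightarrow> 'a set \<times> 'a set set \<Rightarrow> bool" where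
  del_vertex: "v \<in> V \<Longrightarrow> minor_step (V, E) (V - {v}, {e\<in>E. v \<notin> e})"
| del_edge: "e \<in> E \<Longrightarrow> minor_step (V, E) (V, E - {e})"
| contract: "{u, v} \<in> E \<Longrightarrow> u \<noteq> v \<Longrightarrow>
    minor_step (V, E) (V - {v}, {e\<in>E. v \<notin> e} \<union> {{u, w} | w. {v, w} \<in> E \<and> w \<noteq> u})"

definition is_minor :: "'a set \<times> 'a set set \<Rightarrow> 'a set \<times> 'a set set \<Rightarrow> bool" where
  "is_minor H G \<longleftrightarrow> minor_step\<^sup>*\<^sup>* G H"

definition complete_graph :: "'a set \<Rightarrow> 'a set set \<Rightarrow> bool" where
  "complete_graph V E \<longleftrightarrow> E = {{u, v} | u v. u \<in> V \<and> v \<in> V \<and> u \<noteq> v}"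

definition K5_minor_free :: "'a set \<Rightarrow> 'a set set \<Rightarrow> bool" where
  "K5_minor_free V E \<longleftrightarrow>
     \<not> (\<exists>V' E'. is_minor (V', E') (V, E) \<and> card V' = 5 \<and> finite V' \<and> complete_graph V' E')"

definition has_cycle :: "'a set set \<Rightarrow> bool" where
  "has_cycle F \<longleftrightarrow> (\<exists>xs. length xs \<ge> 3 \<and> distinct xs \<and>
      (\<forall>i. Suc i < length xs \<longrightarrow> {xs ! i, xs ! Suc i} \<in> F) \<and> {last xs, hd xs} \<in> F)"

definition is_forest_of :: "'a set set \<Rightarrow> 'a set set \<Rightarrow> bool" where
  "is_forest_of F E \<longleftrightarrow> F \<subseteq> E \<and> \<not> has_cycle F"

definition degree_in :: "'a set set \<Rightarrow> 'a \<Rightarrow> nat" where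
  "degree_in E v = card {e\<in>E. v \<in> e}"

definition two_degenerate :: "'a set \<Rightarrow> 'a set set \<Rightarrow> bool" where
  "two_degenerate V E \<longleftrightarrow>
     (\<forall>V' E'. V' \<subseteq> V \<and> V' \<noteq> {} \<and> E' \<subseteq> E \<and> (\<forall>e\<in>E'. e \<subseteq> V') \<longrightarrow>
        (\<exists>v\<in>V'. degree_in E' v \<le> 2))"

end

theory Submission
  imports Defs
begin

text \<open>
  By induction on the number of vertices one shows more: for every vertex \<open>y\<close> the forest can be
  chosen to contain all edges at \<open>y\<close>. Some neighbour \<open>v\<close> of \<open>y\<close> has at most two common neighbours
  with \<open>y\<close>: otherwise \<open>N(y)\<close> induces a graph of minimum degree at least 3, which has a \<open>K\<^sub>4\<close> minor,
  and \<open>y\<close> extends it to a \<open>K\<^sub>5\<close> minor. Contract \<open>yv\<close> into \<open>y\<close> and take a forest \<open>F'\<close> for the smaller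
  graph. It contains every edge at \<open>y\<close>, so splitting \<open>y\<close> again (a common neighbour keeps its edge to
  \<open>y\<close>, the other neighbours of \<open>v\<close> are attached to \<open>v\<close>, and \<open>yv\<close> is added) gives a forest such that
  only the edges from \<open>v\<close> to the common neighbours, at most two, are new in the complement.
\<close>

section \<open>Branch sets and minors\<close>

lemma simple_graphD:
  assumes "simple_graph V E" "{a, b} \<in> E"
  shows "a \<noteq> b" "a \<in> V" "b \<in> V"
  using assms unfolding simple_graph_def by (metis doubleton_eq_iff)+

lemma simple_graphE:
  assumes "simple_graph V E" "e \<in> E"
  obtains a b where "e = {a, b}" "a \<noteq> b" "a \<in> V" "b \<in> V"
  using assms unfolding simple_graph_def by blast

lemma simple_graph_at:
  assumes "simple_graph V E" "e \<in> E" "v \<in> e"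
  obtains w where "e = {v, w}"
proof -
  obtain a b where "e = {a, b}" using simple_graphE[OF assms(1,2)] by blast
  then have "e = {v, a} \<or> e = {v, b}" using assms(3) by auto
  then show ?thesis using that by blast
qed

text \<open>Connectivity is phrased by cuts instead of paths, so that under a contraction only one
  crossing edge has to be followed. The empty set counts as connected, so nonemptiness is a separate
  demand in \<open>complete_model\<close>.\<close>

definition connected_in :: "'a set set \<Rightarrow> 'a set \<Rightarrow> bool" where
  "connected_in E S \<longleftrightarrow> (\<forall>A B. A \<union> B = S \<and> A \<inter> B = {} \<and> A \<noteq> {} \<and> B \<noteq> {} \<longrightarrow>
     (\<exists>a\<in>A. \<exists>b\<in>B. {a, b} \<in> E))"

text \<open>These are the branch sets of a complete minor with vertices indexed by
  \<open>I\<close>.\<close>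

definition complete_model :: "'a set set \<Rightarrow> 'i set \<Rightarrow> ('i \<Rightarrow> 'a set) \<Rightarrow> bool" where
  "complete_model E I B \<longleftrightarrow> (\<forall>i\<in>I. B i \<noteq> {} \<and> connected_in E (B i)) \<and>
     (\<forall>i\<in>I. \<forall>j\<in>I. i \<noteq> j \<longrightarrow> B i \<inter> B j = {} \<and> (\<exists>a\<in>B i. \<exists>b\<in>B j. {a, b} \<in> E))"

definition contraction :: "'a \<Rightarrow> 'a \<Rightarrow> 'a set set \<Rightarrow> 'a set set" where
  "contraction u v E = {e \<in> E. v \<notin> e} \<union> {{u, w} | w. {v, w} \<in> E \<and> w \<noteq> u}"

lemma minor_step_contraction:
  "{u, v} \<in> E \<Longrightarrow> u \<noteq> v \<Longrightarrow> minor_step (V, E) (V - {v}, contraction u v E)"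
  unfolding contraction_def by (rule minor_step.contract)

lemma simple_graph_contraction:
  assumes "simple_graph V E" "{u, v} \<in> E"
  shows "simple_graph (V - {v}) (contraction u v E)"
  unfolding simple_graph_def
proof
  fix e assume "e \<in> contraction u v E"
  then consider "e \<in> E" "v \<notin> e" | w where "e = {u, w}" "{v, w} \<in> E" "w \<noteq> u"
    unfolding contraction_def by blast
  then show "\<exists>a b. e = {a, b} \<and> a \<noteq> b \<and> a \<in> V - {v} \<and> b \<in> V - {v}"
  proof cases
    case 1
    then show ?thesis using simple_graphE[OF assms(1)] by (metis Diff_iff insertCI singletonD)
  next
    case 2
    then show ?thesis using simple_graphD[OF assms] simple_graphD[OF assms(1) 2(2)] by blast
  qed
qed

lemma simple_graph_del_vertex:
  assumes "simple_graph V E"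
  shows "simple_graph (V - {v}) {e \<in> E. v \<notin> e}"
  unfolding simple_graph_def
proof
  fix e assume e: "e \<in> {e \<in> E. v \<notin> e}"
  then obtain a b where "e = {a, b}" "a \<noteq> b" "a \<in> V" "b \<in> V"
    using simple_graphE[OF assms] by blast
  with e show "\<exists>a b. e = {a, b} \<and> a \<noteq> b \<and> a \<in> V - {v} \<and> b \<in> V - {v}" by blast
qed

lemma contractionI1: "{a, b} \<in> E \<Longrightarrow> a \<noteq> v \<Longrightarrow> b \<noteq> v \<Longrightarrow> {a, b} \<in> contraction u v E"
  unfolding contraction_def by blast

lemma contractionI2: "{v, w} \<in> E \<Longrightarrow> w \<noteq> u \<Longrightarrow> {u, w} \<in> contraction u v E"
  unfolding contraction_def by blast

text \<open>A cut of \<open>S - {v}\<close> becomes a cut of \<open>S\<close> when \<open>v\<close>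
  joins the side of \<open>u\<close>. If the crossing edge ends in \<open>v\<close>, the contraction
  moves this end to \<open>u\<close>, which lies on the same side.\<close>

lemma connected_in_contraction:
  assumes "connected_in E S" "u \<in> S" "u \<noteq> v" "v \<in> S"
  shows "connected_in (contraction u v E) (S - {v})"
proof -
  have main: "\<exists>a\<in>A. \<exists>b\<in>B. {a, b} \<in> contraction u v E"
    if AB: "A \<union> B = S - {v}" "A \<inter> B = {}" "B \<noteq> {}" "u \<in> A" for A B
  proof -
    have "insert v A \<union> B = S" "insert v A \<inter> B = {}" using AB assms by auto
    then obtain a b where ab: "a \<in> insert v A" "b \<in> B" "{a, b} \<in> E"
      using assms(1) AB(3) unfolding connected_in_def by (metis insert_not_empty)
    have "b \<noteq> v" "b \<noteq> u" using AB ab by auto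
    show ?thesis
    proof (cases "a = v")
      case True
      then show ?thesis using ab AB contractionI2 \<open>b \<noteq> u\<close> by metis
    next
      case False
      then show ?thesis using ab contractionI1 \<open>b \<noteq> v\<close> by (metis insertE)
    qed
  qed
  show ?thesis
    unfolding connected_in_def
  proof (intro allI impI, elim conjE)
    fix A B assume AB: "A \<union> B = S - {v}" "A \<inter> B = {}" "A \<noteq> {}" "B \<noteq> {}"
    then have "u \<in> A \<or> u \<in> B" using assms by auto
    then show "\<exists>a\<in>A. \<exists>b\<in>B. {a, b} \<in> contraction u v E"
    proof
      assume "u \<in> A"
      then show ?thesis using main AB by blast
    next
      assume "u \<in> B"
      then have "\<exists>a\<in>B. \<exists>b\<in>A. {a, b} \<in> contraction u v E"
        using main[of B A] AB by blast
      then show ?thesis by (metis insert_commute)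
    qed
  qed
qed

lemma connected_in_mono:
  assumes "connected_in E S" "\<And>a b. a \<in> S \<Longrightarrow> b \<in> S \<Longrightarrow> {a, b} \<in> E \<Longrightarrow> {a, b} \<in> E'"
  shows "connected_in E' S"
  unfolding connected_in_def
proof (intro allI impI)
  fix A B assume AB: "A \<union> B = S \<and> A \<inter> B = {} \<and> A \<noteq> {} \<and> B \<noteq> {}"
  then obtain a b where ab: "a \<in> A" "b \<in> B" "{a, b} \<in> E"
    using assms(1)[unfolded connected_in_def, rule_format, OF AB] by blast
  then have "{a, b} \<in> E'" using assms(2)[of a b] AB by blast
  then show "\<exists>a\<in>A. \<exists>b\<in>B. {a, b} \<in> E'" using ab by blast
qed

lemma connected_in_singleton: "connected_in E {a}"
  unfolding connected_in_def by (auto simp: Un_singleton_iff)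

lemma connected_in_insert:
  assumes "connected_in E S" "s \<in> S" "{s, w} \<in> E"
  shows "connected_in E (insert w S)"
proof (cases "w \<in> S")
  case True
  then show ?thesis using assms(1) by (simp add: insert_absorb)
next
  case False
  show ?thesis
    unfolding connected_in_def
  proof (intro allI impI, elim conjE)
    fix A B assume AB: "A \<union> B = insert w S" "A \<inter> B = {}" "A \<noteq> {}" "B \<noteq> {}"
    show "\<exists>a\<in>A. \<exists>b\<in>B. {a, b} \<in> E"
    proof (cases "A - {w} = {} \<or> B - {w} = {}")
      case True
      then have "A = {w} \<or> B = {w}" using AB(3,4) by blast
      moreover have "s \<in> A \<union> B" "s \<noteq> w" using AB(1) assms(2) False by auto
      ultimately have "A = {w} \<and> s \<in> B \<or> B = {w} \<and> s \<in> A" by blast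
      then show ?thesis using assms(3) by (metis insert_commute singletonI)
    next
      case F: False
      have "(A - {w}) \<union> (B - {w}) = S" "(A - {w}) \<inter> (B - {w}) = {}" using AB False by auto
      then show ?thesis using F assms(1) unfolding connected_in_def by (metis DiffD1)
    qed
  qed
qed

text \<open>Induction on the number of vertices: delete a vertex outside all branch sets, or
  contract an edge inside a branch set with two vertices. If neither is possible, the branch sets
  are singletons covering \<open>V\<close>, and the graph is complete already.\<close>

lemma complete_model_imp_minor:
  assumes "finite V" "simple_graph V E" "finite I" "complete_model E I B" "\<And>i. i \<in> I \<Longrightarrow> B i \<subseteq> V"
  shows "\<exists>V' E'. is_minor (V', E') (V, E) \<and> finite V' \<and> card V' = card I \<and> complete_graph V' E'"
  using assms
proof (induction "card V" arbitrary: V E B rule: less_induct)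
  case less
  note simple = less.prems(2) and model = less.prems(4)[unfolded complete_model_def]
  have step: ?case if st: "minor_step (V, E) (V', E')" "V' \<subset> V" "simple_graph V' E'"
    "complete_model E' I B'" "\<And>i. i \<in> I \<Longrightarrow> B' i \<subseteq> V'" for V' E' B'
  proof -
    have "finite V'" "card V' < card V"
      using st(2) less.prems(1) by (auto intro: finite_subset psubset_card_mono)
    then show ?thesis
      using less.hyps[OF _ _ st(3) less.prems(3) st(4,5)] st(1)
      unfolding is_minor_def by (meson converse_rtranclp_into_rtranclp)
  qed
  show ?case
  proof (cases "\<exists>v\<in>V. \<forall>i\<in>I. v \<notin> B i")
    case True
    then obtain v where v: "v \<in> V" "\<forall>i\<in>I. v \<notin> B i" by blast
    let ?E = "{e \<in> E. v \<notin> e}"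
    have "complete_model ?E I B"
      unfolding complete_model_def
    proof (intro conjI ballI impI)
      fix i assume i: "i \<in> I"
      show "B i \<noteq> {}" using model i by blast
      show "connected_in ?E (B i)"
        by (rule connected_in_mono[of E]) (use model i v in auto)
    next
      fix i j assume ij: "i \<in> I" "j \<in> I" "i \<noteq> j"
      show "B i \<inter> B j = {}" using model ij by blast
      obtain a b where "a \<in> B i" "b \<in> B j" "{a, b} \<in> E" using model ij by blast
      moreover have "v \<notin> {a, b}" using calculation v ij by blast
      ultimately show "\<exists>a\<in>B i. \<exists>b\<in>B j. {a, b} \<in> ?E" by blast
    qed
    then show ?thesis
      using step[OF del_vertex[OF v(1), of E] _ simple_graph_del_vertex[OF simple]] v less.prems(5)
      by blast
  next
    case cover: False
    show ?thesis
    proof (cases "\<exists>i\<in>I. \<exists>a\<in>B i. \<exists>b\<in>B i. a \<noteq> b")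
      case True
      then obtain i a b where i: "i \<in> I" "a \<in> B i" "b \<in> B i" "a \<noteq> b" by blast
      \<comment> \<open>The cut between \<open>a\<close> and the rest of \<open>B i\<close> supplies
        an edge at \<open>a\<close> inside the branch set; this edge is contracted.\<close>
      have "{a} \<union> (B i - {a}) = B i" "B i - {a} \<noteq> {}" using i by auto
      then obtain v where v: "v \<in> B i" "v \<noteq> a" "{a, v} \<in> E"
        using model i(1) unfolding connected_in_def
        by (metis Diff_disjoint Diff_iff empty_not_insert singletonD singletonI)
      let ?E = "contraction a v E" and ?B = "\<lambda>j. B j - {v}"
      have other: "?B j = B j" "a \<notin> B j" if "j \<in> I" "j \<noteq> i" for j
        using model i v that by blast+
      have adj_i: "\<exists>x\<in>?B i. \<exists>y\<in>?B j. {x, y} \<in> ?E" if j: "j \<in> I" "j \<noteq> i" for j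
      proof -
        obtain x y where xy: "x \<in> B i" "y \<in> B j" "{x, y} \<in> E" using model i(1) j by metis
        have "y \<noteq> v" "y \<noteq> a" using other j xy by blast+
        then show ?thesis
          using xy other(1)[OF j] i v contractionI1[of x y E v a] contractionI2[of v y E a]
          by (cases "x = v") blast+
      qed
      have "complete_model ?E I ?B"
        unfolding complete_model_def
      proof (intro conjI ballI impI)
        fix j assume j: "j \<in> I"
        show "?B j \<noteq> {}" using model other i v j by (cases "j = i") auto
        show "connected_in ?E (?B j)"
        proof (cases "j = i")
          case True
          then show ?thesis using connected_in_contraction model i v by metis
        next
          case False
          have "connected_in E (B j)" "v \<notin> B j" using model j other(1)[OF j False] by blast+
          then show ?thesis
            unfolding other(1)[OF j False]
            by (elim connected_in_mono) (metis contractionI1)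
        qed
      next
        fix j k assume jk: "j \<in> I" "k \<in> I" "j \<noteq> k"
        show "?B j \<inter> ?B k = {}" using model jk by blast
        consider "j = i" | "k = i" | "j \<noteq> i" "k \<noteq> i" by blast
        then show "\<exists>x\<in>?B j. \<exists>y\<in>?B k. {x, y} \<in> ?E"
        proof cases
          case 1
          then show ?thesis using adj_i jk by blast
        next
          case 2
          then have "\<exists>x\<in>?B k. \<exists>y\<in>?B j. {x, y} \<in> ?E" using adj_i jk by blast
          then show ?thesis by (metis insert_commute)
        next
          case 3
          obtain x y where "x \<in> B j" "y \<in> B k" "{x, y} \<in> E" using model jk by metis
          then show ?thesis using other 3 jk contractionI1 by (metis Diff_iff singletonI)
        qed
      qed
      moreover have "v \<in> V" using less.prems(5) i v by blast
      ultimately show ?thesis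
        using step[OF minor_step_contraction[OF v(3)] _ simple_graph_contraction[OF simple v(3)]]
          v less.prems(5) by blast
    next
      case False
      define f where "f i = (THE a. a \<in> B i)" for i
      have f: "B i = {f i}" if "i \<in> I" for i
      proof -
        have "\<exists>!a. a \<in> B i" using model False that by blast
        then have "f i \<in> B i" unfolding f_def by (rule theI')
        then show ?thesis using False that by blast
      qed
      have "inj_on f I"
      proof (rule inj_onI, rule ccontr)
        fix i j assume ij: "i \<in> I" "j \<in> I" "f i = f j" "i \<noteq> j"
        then have "B i \<inter> B j = {}" using model by blast
        then show False using f ij by auto
      qed
      moreover have V: "V = f ` I" using f cover less.prems(5) by force
      ultimately have "card V = card I" by (simp add: card_image)
      moreover have "complete_graph V E"
        unfolding complete_graph_def
      proof (intro equalityI subsetI)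
        fix e assume "e \<in> E"
        then show "e \<in> {{u, v} |u v. u \<in> V \<and> v \<in> V \<and> u \<noteq> v}"
          using simple_graphE[OF simple] by (smt (verit) mem_Collect_eq)
      next
        fix e assume "e \<in> {{u, v} |u v. u \<in> V \<and> v \<in> V \<and> u \<noteq> v}"
        then obtain i j where ij: "i \<in> I" "j \<in> I" "e = {f i, f j}" "f i \<noteq> f j"
          using V by blast
        then have "i \<noteq> j" by blast
        then have "\<exists>a\<in>B i. \<exists>b\<in>B j. {a, b} \<in> E" using model ij by blast
        then show "e \<in> E" using f ij by auto
      qed
      ultimately show ?thesis
        using less.prems(1) unfolding is_minor_def by blast
    qed
  qed
qed

section \<open>Minimum degree three forces a \<open>K\<^sub>4\<close> model\<close>

text \<open>Here \<open>n\<close> counts vertices, and the values of \<open>p\<close> from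
  \<open>n\<close> on are arbitrary. With paths as functions, rotation is a reindexing and branch
  sets are images of intervals.\<close>

definition vertex_path :: "'a set set \<Rightarrow> 'a set \<Rightarrow> nat \<Rightarrow> (nat \<Rightarrow> 'a) \<Rightarrow> bool" where
  "vertex_path E N n p \<longleftrightarrow> inj_on p {..<n} \<and> p ` {..<n} \<subseteq> N \<and>
     (\<forall>i. Suc i < n \<longrightarrow> {p i, p (Suc i)} \<in> E)"

lemma vertex_path_Cons:
  assumes "vertex_path E N n p" "w \<in> N" "w \<notin> p ` {..<n}" "{w, p 0} \<in> E"
  shows "vertex_path E N (Suc n) (case_nat w p)"
proof -
  let ?q = "case_nat w p"
  have img: "?q ` {..<Suc n} = insert w (p ` {..<n})"
    by (simp add: lessThan_Suc_eq_insert_0 image_image)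
  have "inj_on ?q (Suc ` {..<n})"
    using assms(1) unfolding vertex_path_def by (simp add: inj_on_def)
  then have "inj_on ?q {..<Suc n}"
    using assms(3) by (simp add: lessThan_Suc_eq_insert_0 image_image)
  moreover have "{?q i, ?q (Suc i)} \<in> E" if "Suc i < Suc n" for i
    using assms(1,4) that unfolding vertex_path_def by (cases i) simp_all
  ultimately show ?thesis
    using assms(1,2) unfolding vertex_path_def img by blast
qed

text \<open>This is a Posa rotation: the new path is \<open>p (i - 1)\<close>, ...,
  \<open>p 0\<close>, \<open>p i\<close>, ..., \<open>p (n - 1)\<close>, and the edge from
  \<open>p 0\<close> to \<open>p i\<close> joins its two pieces.\<close>

lemma vertex_path_rotate:
  assumes p: "vertex_path E N n p" and i: "0 < i" "i < n" "{p 0, p i} \<in> E"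
  shows "vertex_path E N n (\<lambda>k. if k < i then p (i - 1 - k) else p k)"
proof -
  let ?q = "\<lambda>k. if k < i then p (i - 1 - k) else p k"
  let ?s = "\<lambda>k. if k < i then i - 1 - k else k"
  have q: "?q = p \<circ> ?s" by auto
  have "inj_on ?s {..<n}" by (rule inj_onI) (auto split: if_splits)
  moreover have s: "?s ` {..<n} \<subseteq> {..<n}" using i by auto
  ultimately have "inj_on ?q {..<n}"
    unfolding q using p by (meson comp_inj_on inj_on_subset vertex_path_def)
  moreover have "?q ` {..<n} \<subseteq> N"
    using p s unfolding q vertex_path_def image_comp[symmetric] by blast
  moreover have "{?q k, ?q (Suc k)} \<in> E" if k: "Suc k < n" for k
  proof -
    consider "Suc k < i" | "Suc k = i" | "i \<le> k" by linarith
    then show ?thesis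
    proof cases
      case 1
      then have "i - 1 - k = Suc (i - 1 - Suc k)" "Suc (i - 1 - Suc k) < n" using i k by auto
      then have "{p (i - 1 - Suc k), p (i - 1 - k)} \<in> E"
        using p unfolding vertex_path_def by metis
      then show ?thesis using 1 by (simp add: insert_commute)
    next
      case 2
      then show ?thesis using i by auto
    next
      case 3
      then show ?thesis using p k unfolding vertex_path_def by auto
    qed
  qed
  ultimately show ?thesis unfolding vertex_path_def by blast
qed

lemma connected_in_vertex_path:
  assumes "vertex_path E N n p" "l \<le> h" "h < n"
  shows "connected_in E (p ` {l..h})"
  using assms(2,3)
proof (induction h rule: dec_induct)
  case base
  then show ?case by (simp add: connected_in_singleton)
next
  case (step h)
  then have "connected_in E (insert (p (Suc h)) (p ` {l..h}))"
    using assms(1) unfolding vertex_path_def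
    by (intro connected_in_insert[of _ _ "p h"]) auto
  then show ?case using step by (simp add: atLeastAtMostSuc_conv)
qed

lemma card_ge_3_avoid:
  assumes "3 \<le> card A"
  obtains x where "x \<in> A" "x \<noteq> a" "x \<noteq> b"
proof -
  have "\<not> A \<subseteq> {a, b}"
  proof
    assume "A \<subseteq> {a, b}"
    then have "card A \<le> card {a, b}" by (intro card_mono) auto
    also have "\<dots> \<le> 2" by (simp add: card_insert_if)
    finally show False using assms by simp
  qed
  then show ?thesis using that by blast
qed

text \<open>
  Take a longest path \<open>p\<close>, and among all longest paths the least \<open>i \<ge> 2\<close> with \<open>p 0\<close> adjacent to
  \<open>p i\<close>. The start \<open>p 0\<close> has a further neighbour \<open>p j\<close>, \<open>j > i\<close>. Reversing the segment before \<open>i\<close>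
  gives a longest path starting in \<open>p (i - 1)\<close>, so the choice of \<open>i\<close> puts the third neighbour of
  \<open>p (i - 1)\<close> at some \<open>p k\<close> with \<open>k > i\<close>. Cutting \<open>p\<close> before \<open>i - 1\<close>, \<open>i\<close> and \<open>min j k\<close> gives the
  four branch sets.
\<close>

lemma min_degree_3_imp_K4_model:
  assumes fin: "finite N" and ne: "N \<noteq> {}"
    and irrefl: "\<And>a. {a} \<notin> E"
    and deg: "\<And>a. a \<in> N \<Longrightarrow> 3 \<le> card {b \<in> N. {a, b} \<in> E}"
  shows "\<exists>B. complete_model E {..<4::nat} B \<and> (\<forall>i<4. B i \<subseteq> N)"
proof -
  define P where "P n \<longleftrightarrow> (\<exists>p. vertex_path E N n p)" for n
  obtain a where "a \<in> N" using ne by blast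
  then have "P 1" unfolding P_def vertex_path_def inj_on_def by (intro exI[of _ "\<lambda>_. a"]) auto
  have bound: "n \<le> card N" if "P n" for n
    using that fin unfolding P_def vertex_path_def by (metis card_inj_on_le card_lessThan)
  define n where "n = Greatest P"
  have "P n" unfolding n_def using \<open>P 1\<close> bound by (rule GreatestI_nat)
  have max: "m \<le> n" if "P m" for m unfolding n_def using that bound by (rule Greatest_le_nat)
  have "n \<ge> 1" using max \<open>P 1\<close> by blast
  \<comment> \<open>A neighbour of the start off the path could be prepended, against the maximality
    of \<open>n\<close>.\<close>
  have nbr: "b \<in> p ` {..<n}" if "vertex_path E N n p" "b \<in> N" "{p 0, b} \<in> E" for p b
    using vertex_path_Cons[of E N n p b] that max[of "Suc n"]
    unfolding P_def by (metis insert_commute not_less_eq_eq order_refl)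
  have start: "\<exists>k<n. k \<noteq> a \<and> k \<noteq> b \<and> {p 0, p k} \<in> E" if p: "vertex_path E N n p" for p a b
  proof -
    have "p 0 \<in> N" using p \<open>n \<ge> 1\<close> unfolding vertex_path_def by auto
    then obtain w where w: "w \<in> N" "{p 0, w} \<in> E" "w \<noteq> p a" "w \<noteq> p b"
      using card_ge_3_avoid[OF deg] by blast
    then obtain k where "k < n" "w = p k" using nbr[OF p] by blast
    then show ?thesis using w by metis
  qed
  define Q where "Q i \<longleftrightarrow> 2 \<le> i \<and> i < n \<and> (\<exists>p. vertex_path E N n p \<and> {p 0, p i} \<in> E)" for i
  obtain p0 where p0: "vertex_path E N n p0" using \<open>P n\<close> unfolding P_def by blast
  obtain k0 where "k0 < n" "k0 \<noteq> 0" "k0 \<noteq> 1" "{p0 0, p0 k0} \<in> E" using start[OF p0] by blast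
  then have "Q k0" unfolding Q_def using p0 by auto
  define i where "i = Least Q"
  have "Q i" unfolding i_def using \<open>Q k0\<close> by (rule LeastI)
  then obtain p where p: "vertex_path E N n p" "{p 0, p i} \<in> E" and i: "2 \<le> i" "i < n"
    unfolding Q_def by blast
  have least: "i \<le> m" if "Q m" for m unfolding i_def using that by (rule Least_le)
  \<comment> \<open>The indices 1 and \<open>i\<close> are avoided explicitly, and 0 is ruled out by
    the absence of loops; so \<open>j\<close> is at least 2 and minimality of \<open>i\<close> gives
    \<open>i < j\<close>.\<close>
  obtain j where j: "j < n" "j \<noteq> 1" "j \<noteq> i" "{p 0, p j} \<in> E" using start[OF p(1)] by blast
  have "j \<noteq> 0" using j(4) irrefl by (metis insert_absorb2)
  then have "i < j" using least[of j] j p(1) unfolding Q_def by fastforce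
  define q where "q k = (if k < i then p (i - 1 - k) else p k)" for k
  have q: "vertex_path E N n q"
    using vertex_path_rotate[OF p(1) _ i(2) p(2)] i unfolding q_def by simp
  \<comment> \<open>Since \<open>q 0\<close>, \<open>q 1\<close>, \<open>q i\<close> are
    \<open>p (i - 1)\<close>, \<open>p (i - 2)\<close>, \<open>p i\<close>, the two neighbours of
    \<open>p (i - 1)\<close> on \<open>p\<close> are avoided. \<open>Q\<close> ranges over all
    longest paths, so minimality of \<open>i\<close> applies to \<open>q\<close> as well; beyond
    \<open>i\<close> the paths \<open>p\<close> and \<open>q\<close> agree.\<close>
  obtain k where k: "k < n" "k \<noteq> 1" "k \<noteq> i" "{q 0, q k} \<in> E" using start[OF q] by blast
  have "k \<noteq> 0" using k(4) irrefl by (metis insert_absorb2)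
  then have "i < k" using least[of k] k q unfolding Q_def by fastforce
  have pk: "{p (i - 1), p k} \<in> E" using k(4) i \<open>i < k\<close> by (simp add: q_def)
  define m where "m = min j k"
  define M where "M = max j k"
  have mM: "i < m" "m \<le> j" "j \<le> M" "m \<le> k" "k \<le> M" "M < n"
    using \<open>i < j\<close> \<open>i < k\<close> j k unfolding m_def M_def by auto
  \<comment> \<open>The four segments are \<open>{0..i - 2}\<close>, \<open>{i - 1}\<close>,
    \<open>{i..m - 1}\<close> and \<open>{m..M}\<close>; the last contains both \<open>j\<close> and
    \<open>k\<close>. The value \<open>L 0 = 0\<close> is the default.\<close>
  define L where "L = (\<lambda>_::nat. 0 :: nat)(1 := i - 1, 2 := i, 3 := m)"
  define H where "H = (\<lambda>_::nat. 0 :: nat)(0 := i - 2, 1 := i - 1, 2 := m - 1, 3 := M)"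
  define B where "B t = p ` {L t..H t}" for t :: nat
  have LH: "L t \<le> H t" "H t < n" if "t < 4" for t
    using that mM i by (auto simp: L_def H_def less_Suc_eq numeral_eq_Suc)
  have sep: "H s < L t" if "s < t" "t < 4" for s t
    using that mM i by (auto simp: L_def H_def less_Suc_eq numeral_eq_Suc)
  have suc: "{p t, p (Suc t)} \<in> E" if "Suc t < n" for t
    using p(1) that unfolding vertex_path_def by blast
  have mem: "p x \<in> B t" if "L t \<le> x" "x \<le> H t" for x t
    using that unfolding B_def by auto
  have adj: "\<exists>a\<in>B s. \<exists>b\<in>B t. {a, b} \<in> E" if st: "s < t" "t < 4" for s t
  proof -
    \<comment> \<open>Path edges join consecutive segments. The pairs (0,2), (0,3) and (1,3) are
      joined by the edges from \<open>p 0\<close> to \<open>p i\<close>, from \<open>p 0\<close> to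
      \<open>p j\<close> and from \<open>p (i - 1)\<close> to \<open>p k\<close>.\<close>
    have "{p (i - 2), p (i - 1)} \<in> E" "{p (i - 1), p i} \<in> E" "{p (m - 1), p m} \<in> E"
      using suc[of "i - 2"] suc[of "i - 1"] suc[of "m - 1"] i mM
      by (auto simp: numeral_2_eq_2 Suc_diff_Suc)
    moreover have "p 0 \<in> B 0" "p (i - 2) \<in> B 0" "p (i - 1) \<in> B 1" "p i \<in> B 2" "p (m - 1) \<in> B 2"
      "p m \<in> B 3" "p j \<in> B 3" "p k \<in> B 3"
      using i mM by (auto intro!: mem simp: L_def H_def)
    moreover have "s = 0 \<and> t = 1 \<or> s = 0 \<and> t = 2 \<or> s = 0 \<and> t = 3 \<or> s = 1 \<and> t = 2 \<or>
      s = 1 \<and> t = 3 \<or> s = 2 \<and> t = 3" using st by auto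
    ultimately show ?thesis using p(2) j(4) pk by blast
  qed
  have disj: "B s \<inter> B t = {}" if st: "s < t" "t < 4" for s t
  proof -
    have "{L s..H s} \<inter> {L t..H t} = {}" "{L s..H s} \<subseteq> {..<n}" "{L t..H t} \<subseteq> {..<n}"
      using sep[OF st] LH[of s] LH[of t] st by auto
    then show ?thesis
      using p(1) unfolding B_def vertex_path_def by (metis image_empty inj_on_image_Int)
  qed
  have "complete_model E {..<4} B"
    unfolding complete_model_def
  proof (intro conjI ballI impI)
    fix t :: nat assume "t \<in> {..<4}"
    then show "B t \<noteq> {}" "connected_in E (B t)"
      using LH[of t] connected_in_vertex_path[OF p(1)] unfolding B_def by auto
  next
    fix s t :: nat assume st: "s \<in> {..<4}" "t \<in> {..<4}" "s \<noteq> t"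
    then consider "s < t" "t < 4" | "t < s" "s < 4" by fastforce
    note cs = this
    show "B s \<inter> B t = {}" using cs by cases (use disj in blast)+
    show "\<exists>a\<in>B s. \<exists>b\<in>B t. {a, b} \<in> E"
      using cs by cases (use adj in \<open>metis insert_commute\<close>)+
  qed
  moreover have "B t \<subseteq> N" if "t < 4" for t
  proof -
    have "{L t..H t} \<subseteq> {..<n}" using LH[OF that] by auto
    then show ?thesis using p(1) unfolding B_def vertex_path_def by blast
  qed
  ultimately show ?thesis by blast
qed

text \<open>The common neighbours of \<open>y\<close> and \<open>v\<close> are the neighbours of
  \<open>v\<close> inside \<open>N(y)\<close>. If there were always three, \<open>N(y)\<close> would
  carry four branch sets of a complete model, and \<open>{y}\<close> would be the fifth.\<close>

lemma K5_minor_free_few_common_neighbours: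
  assumes fin: "finite V" and simple: "simple_graph V E" and free: "K5_minor_free V E"
    and ne: "{y, v0} \<in> E"
  obtains v where "{y, v} \<in> E" "card {w. {y, w} \<in> E \<and> {v, w} \<in> E} \<le> 2"
proof (rule ccontr)
  assume "\<not> thesis"
  then have many: "\<And>v. {y, v} \<in> E \<Longrightarrow> \<not> card {w. {y, w} \<in> E \<and> {v, w} \<in> E} \<le> 2"
    using that by blast
  define N where "N = {w. {y, w} \<in> E}"
  have NV: "N \<subseteq> V" and yN: "y \<notin> N" and yV: "y \<in> V"
    using simple_graphD[OF simple] ne unfolding N_def by blast+
  have "\<exists>B. complete_model E {..<4::nat} B \<and> (\<forall>i<4. B i \<subseteq> N)"
  proof (rule min_degree_3_imp_K4_model)
    show "finite N" using NV fin by (rule finite_subset)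
    show "N \<noteq> {}" using ne unfolding N_def by blast
    show "{a} \<notin> E" for a using simple_graphD(1)[OF simple, of a a] by auto
    show "3 \<le> card {b \<in> N. {a, b} \<in> E}" if "a \<in> N" for a
      using many[of a] that unfolding N_def by simp
  qed
  then obtain B where B: "complete_model E {..<4::nat} B" "\<And>i. i < 4 \<Longrightarrow> B i \<subseteq> N" by blast
  note model = B(1)[unfolded complete_model_def]
  define B' where "B' = B(4 := {y})"
  have adj4: "\<exists>a\<in>B i. {y, a} \<in> E" and ynB: "y \<notin> B i" if "i < 4" for i
    using model B(2)[OF that] that yN unfolding N_def by blast+
  have "complete_model E {..<5} B'"
    unfolding complete_model_def
  proof (intro conjI ballI impI)
    fix i :: nat assume "i \<in> {..<5}"
    then have "i < 4 \<or> i = 4" by auto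
    then show "B' i \<noteq> {}" "connected_in E (B' i)"
      using model connected_in_singleton unfolding B'_def by auto
  next
    fix i j :: nat assume ij: "i \<in> {..<5}" "j \<in> {..<5}" "i \<noteq> j"
    then consider "i < 4" "j < 4" | "i < 4" "j = 4" | "j < 4" "i = 4" by fastforce
    note cs = this
    show "B' i \<inter> B' j = {}"
      using cs by cases (use model ij ynB in \<open>auto simp: B'_def\<close>)
    show "\<exists>a\<in>B' i. \<exists>b\<in>B' j. {a, b} \<in> E"
      using cs
    proof cases
      case 1
      then show ?thesis using model ij unfolding B'_def by auto
    next
      case 2
      then show ?thesis using adj4[of i] unfolding B'_def by (auto simp: insert_commute)
    next
      case 3
      then show ?thesis using adj4[of j] unfolding B'_def by auto
    qed
  qed
  moreover have "B' i \<subseteq> V" if "i \<in> {..<5}" for i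
  proof -
    have "i < 4 \<or> i = 4" using that by auto
    then show ?thesis using B(2)[of i] NV yV unfolding B'_def by auto
  qed
  ultimately have "\<exists>V' E'. is_minor (V', E') (V, E) \<and> finite V' \<and> card V' = card {..<5::nat} \<and>
      complete_graph V' E'"
    by (intro complete_model_imp_minor[OF fin simple]) auto
  then show False using free unfolding K5_minor_free_def by auto
qed

section \<open>The decomposition\<close>

lemma K5_minor_free_step:
  assumes "K5_minor_free V E" "minor_step (V, E) (V', E')"
  shows "K5_minor_free V' E'"
  using assms unfolding K5_minor_free_def is_minor_def
  by (meson converse_rtranclp_into_rtranclp)

text \<open>
  Acyclicity in the form in which it survives the splitting of \<open>y\<close>: every vertex set has, outside
  the root \<open>y\<close>, a vertex with at most one neighbour in the set.
\<close>

definition rooted_forest :: "'a set \<Rightarrow> 'a set set \<Rightarrow> 'a \<Rightarrow> bool" where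
  "rooted_forest V F y \<longleftrightarrow> (\<forall>W. W \<subseteq> V \<and> W - {y} \<noteq> {} \<longrightarrow>
     (\<exists>w\<in>W - {y}. \<forall>a\<in>W. \<forall>b\<in>W. {w, a} \<in> F \<and> {w, b} \<in> F \<longrightarrow> a = b))"

lemma rooted_forestE:
  assumes "rooted_forest V F y" "W \<subseteq> V" "W - {y} \<noteq> {}"
  obtains w where "w \<in> W - {y}"
    "\<forall>a\<in>W. \<forall>b\<in>W. {w, a} \<in> F \<and> {w, b} \<in> F \<longrightarrow> a = b"
proof -
  have "\<exists>w\<in>W - {y}. \<forall>a\<in>W. \<forall>b\<in>W. {w, a} \<in> F \<and> {w, b} \<in> F \<longrightarrow> a = b"
    using assms unfolding rooted_forest_def by simp
  then show ?thesis using that by (elim bexE)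
qed

text \<open>On the vertex set of a cycle every vertex has two distinct neighbours, its predecessor
  and its successor. Exempting the root does not help, as a cycle has at least three
  vertices.\<close>

lemma rooted_forest_acyclic:
  assumes forest: "rooted_forest V F y" and simple: "simple_graph V F"
  shows "\<not> has_cycle F"
proof
  assume "has_cycle F"
  then obtain xs where xs: "length xs \<ge> 3" "distinct xs"
    "\<And>i. Suc i < length xs \<Longrightarrow> {xs ! i, xs ! Suc i} \<in> F" "{last xs, hd xs} \<in> F"
    unfolding has_cycle_def by blast
  let ?n = "length xs"
  define s where "s i = (if Suc i < ?n then Suc i else 0)" for i
  have s_less: "s i < ?n" for i using xs(1) unfolding s_def by auto
  have s_edge: "{xs ! i, xs ! s i} \<in> F" if i: "i < ?n" for i
  proof (cases "Suc i < ?n")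
    case True
    then show ?thesis using xs(3) by (simp add: s_def)
  next
    case False
    then have "i = ?n - 1" using i by simp
    then have "xs ! i = last xs" "xs ! 0 = hd xs"
      using xs(1) last_conv_nth[of xs] hd_conv_nth[of xs] by fastforce+
    then show ?thesis using xs(4) False by (simp add: s_def)
  qed
  have two: "\<exists>a\<in>set xs. \<exists>b\<in>set xs. {w, a} \<in> F \<and> {w, b} \<in> F \<and> a \<noteq> b"
    if w: "w \<in> set xs" for w
  proof -
    obtain i where i: "i < ?n" "w = xs ! i" using w by (auto simp: in_set_conv_nth)
    \<comment> \<open>\<open>j\<close> is the cyclic predecessor of \<open>i\<close>; it differs
      from the successor \<open>s i\<close> because the length is at least 3.\<close>
    define j where "j = (if i = 0 then ?n - 1 else i - 1)"
    have j: "j < ?n" "s j = i" "j \<noteq> s i" using i xs(1) unfolding j_def s_def by auto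
    have "xs ! j \<noteq> xs ! s i" using j xs(2) s_less by (simp add: nth_eq_iff_index_eq)
    moreover have "{w, xs ! s i} \<in> F" using s_edge[OF i(1)] i(2) by simp
    moreover have "{w, xs ! j} \<in> F" using s_edge[OF j(1)] j(2) i(2) by (simp add: insert_commute)
    moreover have "xs ! j \<in> set xs" "xs ! s i \<in> set xs" using j(1) s_less[of i] by simp_all
    ultimately show ?thesis by blast
  qed
  have "set xs \<subseteq> V" using two simple_graphD(2)[OF simple] by blast
  moreover have "set xs - {y} \<noteq> {}"
  proof
    assume "set xs - {y} = {}"
    then have "card (set xs) \<le> card {y}" by (intro card_mono) auto
    then show False using xs(1,2) by (simp add: distinct_card)
  qed
  ultimately show False
    using forest two unfolding rooted_forest_def by (meson DiffD1)
qed

lemma simple_graph_mono: "simple_graph V E \<Longrightarrow> F \<subseteq> E \<Longrightarrow> simple_graph V F"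
  unfolding simple_graph_def by blast

text \<open>The demand on the edges at \<open>y\<close> carries the induction: the edges created by
  the contraction are all at \<open>y\<close>, so none of them is left in the complement of the
  smaller forest.\<close>

lemma forest_decomposition_at:
  assumes "finite V" "simple_graph V E" "K5_minor_free V E" "y \<in> V"
  shows "\<exists>F\<subseteq>E. {e \<in> E. y \<in> e} \<subseteq> F \<and> rooted_forest V F y \<and> two_degenerate V (E - F)"
  using assms
proof (induction "card V" arbitrary: V E y rule: less_induct)
  case less
  note fin = less.prems(1) and simple = less.prems(2) and free = less.prems(3)
  note D = simple_graphD[OF simple]
  show ?case
  proof (cases "\<exists>v. {y, v} \<in> E")
    case True
    then obtain v0 where "{y, v0} \<in> E" by blast
    then obtain v where v: "{y, v} \<in> E" "card {w. {y, w} \<in> E \<and> {v, w} \<in> E} \<le> 2"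
      by (rule K5_minor_free_few_common_neighbours[OF fin simple free])
    have yv: "y \<noteq> v" "y \<in> V" "v \<in> V" using D v(1) by blast+
    let ?V = "V - {v}" and ?E = "contraction y v E"
    have "card ?V < card V" using fin yv(3) by (rule card_Diff1_less)
    moreover have "finite ?V" "y \<in> ?V" using fin yv by auto
    moreover have "K5_minor_free ?V ?E"
      using K5_minor_free_step[OF free minor_step_contraction[OF v(1) yv(1)]] .
    ultimately have "\<exists>F\<subseteq>?E. {e \<in> ?E. y \<in> e} \<subseteq> F \<and> rooted_forest ?V F y \<and>
        two_degenerate ?V (?E - F)"
      using simple_graph_contraction[OF simple v(1)] by (intro less.hyps)
    then obtain F' where "F' \<subseteq> ?E \<and> {e \<in> ?E. y \<in> e} \<subseteq> F' \<and> rooted_forest ?V F' y \<and>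
        two_degenerate ?V (?E - F')" ..
    then have F': "F' \<subseteq> ?E" "{e \<in> ?E. y \<in> e} \<subseteq> F'" "rooted_forest ?V F' y"
      "two_degenerate ?V (?E - F')"
      by simp_all
    \<comment> \<open>For \<open>w\<close> other than \<open>v\<close>, an edge
      \<open>{y, w}\<close> of \<open>F'\<close> is replaced by exactly one edge:
      \<open>{y, w}\<close> itself if it lies in \<open>E\<close>, and \<open>{v, w}\<close>
      otherwise. The edge \<open>{y, v}\<close> is added.\<close>
    define F where "F = {e \<in> F'. y \<notin> e} \<union> {e \<in> E. y \<in> e} \<union> {{v, u} | u. {v, u} \<in> E \<and> {y, u} \<notin> E}"
    have vF': "v \<notin> e" if "e \<in> F'" for e
    proof -
      have "e \<in> ?E" using F'(1) that by (rule subsetD)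
      then show ?thesis using D(1) yv(1) unfolding contraction_def by blast
    qed
    have at_y: "e \<in> F'" if "e \<in> ?E" "y \<in> e" for e
      using F'(2) that by blast
    have off: "e \<in> F'" if "e \<in> F" "y \<notin> e" "v \<notin> e" for e
      using that unfolding F_def by blast
    have at_v: "{y, w} \<notin> E" if w: "{w, v} \<in> F" "w \<noteq> y" "w \<noteq> v" for w
    proof -
      have "{w, v} \<notin> F'" using vF' by blast
      moreover have "y \<notin> {w, v}" using w(2) yv(1) by simp
      ultimately obtain u where u: "{w, v} = {v, u}" "{y, u} \<notin> E"
        using w(1) unfolding F_def by auto
      then show ?thesis using w(3) by (auto simp: doubleton_eq_iff)
    qed
    have "F \<subseteq> E"
    proof
      fix e assume "e \<in> F"
      then consider "e \<in> F'" "y \<notin> e" | "e \<in> E" unfolding F_def by blast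
      then show "e \<in> E"
      proof cases
        case 1
        then have "e \<in> ?E" using F'(1) by blast
        then show ?thesis using 1 unfolding contraction_def by blast
      qed
    qed
    moreover have "{e \<in> E. y \<in> e} \<subseteq> F" unfolding F_def by blast
    moreover have "rooted_forest V F y"
      unfolding rooted_forest_def
    proof (intro allI impI, elim conjE)
      fix W assume W: "W \<subseteq> V" "W - {y} \<noteq> {}"
      show "\<exists>w\<in>W - {y}. \<forall>a\<in>W. \<forall>b\<in>W. {w, a} \<in> F \<and> {w, b} \<in> F \<longrightarrow> a = b"
      proof (cases "W - {y} = {v}")
        case True
        have "{v, v} \<notin> F" using \<open>F \<subseteq> E\<close> D(1)[of v v] by blast
        then have "a = y" if "a \<in> W" "{v, a} \<in> F" for a
          using that True by (cases "a = v") auto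
        then have "\<forall>a\<in>W. \<forall>b\<in>W. {v, a} \<in> F \<and> {v, b} \<in> F \<longrightarrow> a = b"
          by (intro ballI impI) (elim conjE, metis)
        moreover have "v \<in> W - {y}" using True by simp
        ultimately show ?thesis by (rule bexI)
      next
        case False
        \<comment> \<open>\<open>W'\<close> is the image of \<open>W\<close> under the contraction,
          with \<open>y\<close> put in in any case; this does no harm, as the vertex
          \<open>w\<close> found below is not the root and enlarging the set only strengthens its
          property.\<close>
        define W' where "W' = insert y (W - {v})"
        have "W' \<subseteq> ?V" "W' - {y} \<noteq> {}" using W yv False unfolding W'_def by auto
        then obtain w where w: "w \<in> W' - {y}"
          "\<forall>a\<in>W'. \<forall>b\<in>W'. {w, a} \<in> F' \<and> {w, b} \<in> F' \<longrightarrow> a = b"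
          by (rule rooted_forestE[OF F'(3)])
        have w': "w \<in> W - {y}" "w \<noteq> v" using w(1) unfolding W'_def by auto
        \<comment> \<open>The contraction map sends \<open>F\<close>-neighbours of \<open>w\<close>
          in \<open>W\<close> to \<open>F'\<close>-neighbours in \<open>W'\<close>, where there is
          at most one. It identifies only \<open>v\<close> and \<open>y\<close>, and
          \<open>w\<close> is not joined to both in \<open>F\<close>.\<close>
        define r where "r a = (if a = v then y else a)" for a
        have r: "r a \<in> W' \<and> {w, r a} \<in> F'" if a: "a \<in> W" "{w, a} \<in> F" for a
        proof -
          have "{w, a} \<in> E" using a \<open>F \<subseteq> E\<close> by blast
          consider "a = v" | "a = y" | "a \<noteq> v" "a \<noteq> y" by blast
          then show ?thesis
          proof cases
            case 1
            then have "{v, w} \<in> E" using \<open>{w, a} \<in> E\<close> by (simp add: insert_commute)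
            then have "{y, w} \<in> ?E" by (rule contractionI2) (use w' in blast)
            then have "{y, w} \<in> F'" by (rule at_y) simp
            then show ?thesis using 1 by (simp add: r_def W'_def insert_commute)
          next
            case 2
            then have "{w, y} \<in> ?E" using contractionI1[of w y E v y] \<open>{w, a} \<in> E\<close> w' yv by simp
            then have "{w, y} \<in> F'" by (rule at_y) simp
            then show ?thesis using 2 yv by (simp add: r_def W'_def)
          next
            case 3
            have "v \<notin> {w, a}" "y \<notin> {w, a}" using 3 w' by auto
            then have "{w, a} \<in> F'" using a(2) off by blast
            then show ?thesis using 3 a by (simp add: r_def W'_def)
          qed
        qed
        have both: "\<not> ({w, v} \<in> F \<and> {w, y} \<in> F)"
        proof
          assume *: "{w, v} \<in> F \<and> {w, y} \<in> F"
          then have "{w, y} \<in> E" using \<open>F \<subseteq> E\<close> by (meson subsetD)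
          then have "{y, w} \<in> E" by (simp add: insert_commute)
          then show False using at_v[of w] * w' by blast
        qed
        have "a = b" if "a \<in> W" "b \<in> W" "{w, a} \<in> F" "{w, b} \<in> F" for a b
        proof -
          have "r a = r b" using r w(2) that by blast
          then show ?thesis using both that unfolding r_def by (auto split: if_splits)
        qed
        then show ?thesis using w'(1) by blast
      qed
    qed
    moreover have "two_degenerate V (E - F)"
      unfolding two_degenerate_def
    proof (intro allI impI, elim conjE)
      fix V1 E1 assume V1: "V1 \<subseteq> V" "V1 \<noteq> {}" "E1 \<subseteq> E - F" "\<forall>e\<in>E1. e \<subseteq> V1"
      show "\<exists>x\<in>V1. degree_in E1 x \<le> 2"
      proof (cases "v \<in> V1")
        case True
        let ?C = "{w. {y, w} \<in> E \<and> {v, w} \<in> E}"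
        have "?C \<subseteq> V" using D by blast
        then have "finite ?C" using fin by (rule finite_subset)
        \<comment> \<open>\<open>F\<close> contains every edge from \<open>v\<close> to a vertex
          that is not a neighbour of \<open>y\<close>, so the other edges at \<open>v\<close> lead
          to common neighbours.\<close>
        have "{e \<in> E1. v \<in> e} \<subseteq> (\<lambda>w. {v, w}) ` ?C"
        proof
          fix e assume "e \<in> {e \<in> E1. v \<in> e}"
          then have e: "e \<in> E" "e \<notin> F" "v \<in> e" using V1(3) by auto
          obtain w where w: "e = {v, w}" by (rule simple_graph_at[OF simple e(1,3)])
          then have "{y, w} \<in> E" using e(1,2) unfolding F_def by blast
          then show "e \<in> (\<lambda>w. {v, w}) ` ?C" using w e by blast
        qed
        then have "card {e \<in> E1. v \<in> e} \<le> card ?C"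
          using \<open>finite ?C\<close> by (meson card_image_le card_mono finite_imageI le_trans)
        then have "degree_in E1 v \<le> 2" using v(2) unfolding degree_in_def by (rule le_trans)
        then show ?thesis using True by (rule bexI)
      next
        case False
        \<comment> \<open>An edge of \<open>E1\<close> avoids \<open>v\<close>, and it avoids
          \<open>y\<close> because all edges at \<open>y\<close> lie in \<open>F\<close>; so the
          contraction leaves it unchanged.\<close>
        have "E1 \<subseteq> ?E - F'"
        proof
          fix e assume e: "e \<in> E1"
          then have "e \<in> E" "e \<notin> F" "v \<notin> e" using V1 False by auto
          moreover have "y \<notin> e" using calculation unfolding F_def by blast
          ultimately show "e \<in> ?E - F'" unfolding F_def contraction_def by blast
        qed
        moreover have "V1 \<subseteq> ?V" using V1 False by blast
        ultimately show ?thesis using F'(4) V1 unfolding two_degenerate_def by blast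
      qed
    qed
    ultimately show ?thesis by (intro exI[of _ F] conjI)
  next
    \<comment> \<open>Now \<open>y\<close> is isolated. Unless there are no edges at all,
      \<open>y\<close> is deleted and the induction hypothesis is applied with an endpoint
      \<open>a\<close> of some edge as root.\<close>
    case False
    have yE: "y \<notin> e" if "e \<in> E" for e
      using simple_graph_at[OF simple that] False that by metis
    show ?thesis
    proof (cases "E = {}")
      case True
      have "two_degenerate V {}" unfolding two_degenerate_def degree_in_def by auto
      moreover have "rooted_forest V {} y" unfolding rooted_forest_def by auto
      ultimately show ?thesis using True by auto
    next
      case False
      then obtain a b where ab: "{a, b} \<in> E" "a \<noteq> b" "a \<in> V"
        using simple_graphE[OF simple] by (metis ex_in_conv)
      have "a \<noteq> y" using ab(1) yE by blast
      let ?V = "V - {y}"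
      have E: "{e \<in> E. y \<notin> e} = E" using yE by blast
      have "minor_step (V, E) (?V, E)"
        using del_vertex[OF less.prems(4), of E] unfolding E .
      then have "K5_minor_free ?V E" using K5_minor_free_step[OF free] by blast
      moreover have "simple_graph ?V E"
        using simple_graph_del_vertex[OF simple, of y] unfolding E .
      moreover have "card ?V < card V" using fin less.prems(4) by (rule card_Diff1_less)
      moreover have "finite ?V" "a \<in> ?V" using fin ab(3) \<open>a \<noteq> y\<close> by auto
      ultimately have "\<exists>F\<subseteq>E. {e \<in> E. a \<in> e} \<subseteq> F \<and> rooted_forest ?V F a \<and>
          two_degenerate ?V (E - F)"
        by (intro less.hyps)
      then obtain F where "F \<subseteq> E \<and> {e \<in> E. a \<in> e} \<subseteq> F \<and> rooted_forest ?V F a \<and>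
          two_degenerate ?V (E - F)" ..
      then have F: "F \<subseteq> E" "rooted_forest ?V F a" "two_degenerate ?V (E - F)"
        by simp_all
      have yF: "{w, y} \<notin> F" for w using F(1) yE by blast
      have "rooted_forest V F y"
        unfolding rooted_forest_def
      proof (intro allI impI, elim conjE)
        fix W assume W: "W \<subseteq> V" "W - {y} \<noteq> {}"
        show "\<exists>w\<in>W - {y}. \<forall>b\<in>W. \<forall>c\<in>W. {w, b} \<in> F \<and> {w, c} \<in> F \<longrightarrow> b = c"
        \<comment> \<open>The root moves from \<open>a\<close> to \<open>y\<close>. If
          \<open>a\<close> is the only vertex of \<open>W\<close> besides possibly \<open>y\<close>,
          it has no neighbour in \<open>W\<close>; otherwise the property of \<open>W - {y}\<close>
          carries over because \<open>y\<close> is isolated.\<close>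
        proof (cases "W - {y} \<subseteq> {a}")
          case True
          then have "{a, b} \<notin> F" if "b \<in> W" for b
            using that yF F(1) D(1) by (cases "b = y") blast+
          then show ?thesis using True W(2) by blast
        next
          case False
          then have "W - {y} \<subseteq> ?V" "W - {y} - {a} \<noteq> {}" using W by auto
          then obtain w where w: "w \<in> W - {y} - {a}"
            "\<forall>b\<in>W - {y}. \<forall>c\<in>W - {y}. {w, b} \<in> F \<and> {w, c} \<in> F \<longrightarrow> b = c"
            by (rule rooted_forestE[OF F(2)])
          have "b = c" if "b \<in> W" "c \<in> W" "{w, b} \<in> F" "{w, c} \<in> F" for b c
          proof -
            have "b \<noteq> y" "c \<noteq> y" using that yF by blast+
            then show ?thesis using w(2) that by simp
          qed
          then show ?thesis using w(1) by blast
        qed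
      qed
      moreover have "two_degenerate V (E - F)"
        unfolding two_degenerate_def
      proof (intro allI impI, elim conjE)
        fix V1 E1 assume V1: "V1 \<subseteq> V" "V1 \<noteq> {}" "E1 \<subseteq> E - F" "\<forall>e\<in>E1. e \<subseteq> V1"
        show "\<exists>x\<in>V1. degree_in E1 x \<le> 2"
        proof (cases "y \<in> V1")
          case True
          have "{e \<in> E1. y \<in> e} = {}" using V1(3) yE by blast
          then have "degree_in E1 y \<le> 2" unfolding degree_in_def by (metis card.empty zero_le)
          then show ?thesis using True by blast
        next
          case False
          then have "V1 \<subseteq> ?V" using V1(1) by blast
          then show ?thesis using F(3) V1 unfolding two_degenerate_def by blast
        qed
      qed
      moreover have "{e \<in> E. y \<in> e} \<subseteq> F" using yE by blast
      ultimately show ?thesis using F(1) by (intro exI[of _ F] conjI)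
    qed
  qed
qed

theorem theorem1p7:
  fixes V :: "'a set" and E :: "'a set set"
  assumes "finite V" and "simple_graph V E" and "K5_minor_free V E"
  shows "\<exists>F. is_forest_of F E \<and> two_degenerate V (E - F)"
proof (cases "V = {}")
  \<comment> \<open>The empty graph has no vertex to serve as root.\<close>
  case True
  then have "is_forest_of {} E" "two_degenerate V (E - {})"
    unfolding is_forest_of_def has_cycle_def two_degenerate_def by auto
  then show ?thesis by blast
next
  case False
  then obtain y where "y \<in> V" by blast
  then obtain F where "F \<subseteq> E \<and> {e \<in> E. y \<in> e} \<subseteq> F \<and> rooted_forest V F y \<and>
      two_degenerate V (E - F)"
    using forest_decomposition_at[OF assms] by metis
  then have F: "F \<subseteq> E" "rooted_forest V F y" "two_degenerate V (E - F)"
    by simp_all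
  have "\<not> has_cycle F"
    using rooted_forest_acyclic[OF F(2) simple_graph_mono[OF assms(2) F(1)]] .
  then show ?thesis
    using F(1,3) unfolding is_forest_of_def by (intro exI[of _ F] conjI)
qed

end
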